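(* Let $Z$ be a Tychonoff space and let $Y=\operatorname{span}(f_0)$ be a subspace of $X=C_p(Z)$. Then $Y$ has the property-SNP with respect to $\mathcal{P}=\{\rho_F:F\subseteq Z\text{ is finite}\}$, where $\rho_F(f)=\max_{x\in F}|f(x)|$ for all $f\in C(Z)$, if and only if $f_0$ attains its supremum at exactly one point, i.e. there is exactly one $z\in Z$ with $|f_0(z)|=\sup_{x\in Z}|f_0(x)|$.
   Context: $C(Z)$ is the space of real-valued continuous functions on $Z$, and $C_p(Z)$ is $C(Z)$ with the topology of pointwise convergence, which is induced by the directed family $\mathcal{P}$. $X^*$ is the continuous dual of $X$ and $Y^*$ the dual of $Y$ with the subspace topology. For seminorms, $\rho\succeq\mu$ means $\rho(f)\ge\mu(f)$ for all $f$. For $\rho\in\mathcal{P}$, $\phi\in X^*$, $h\in Y^*$: $\chi_\rho^X(\phi)=\sup\{|\phi(f)|:f\in X,\rho(f)\le1\}\in[0,\infty]$, $\chi_\rho^Y(h)=\sup\{|h(f)|:f\in Y,\rho(f)\le1\}\in[0,\infty]$. For $h\in Y^*$ and $\rho\in\mathcal{P}$ with $\chi_\rho^Y(h)<\infty$, a Hahn-Banach extension (HBE) of the pair $(h,\rho)$ is an $\widetilde h\in X^*$ with $\widetilde h|_Y=h$ and $\chi_\rho^X(\widetilde h)=\chi_\rho^Y(h)$. $Y$ has property-SNP with respect to $\mathcal{P}$ if for every $h\in Y^*$ there are $\mu\in\mathcal{P}$ with $\chi_\mu^Y(h)<\infty$ and $\widetilde h\in X^*$ such that for every $\rho\in\mathcal{P}$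 with $\rho\succeq\mu$, $\widetilde h$ is the unique HBE of $(h,\rho)$ (the same $\widetilde h$ for all these $\rho$).
   Formalization: The function f_0 is assumed to be nonzero; for f_0 = 0 on a space Z with at least two points, Y = {0} has property-SNP although |f_0| attains its supremum at every point. *)

theory Defs
  imports "HOL-Analysis.Analysis" "HOL-Library.Function_Algebras"
begin

instantiation "fun" :: (type, real_vector) real_vector
begin

definition scaleR_fun :: "real \<Rightarrow> ('a \<Rightarrow> 'b) \<Rightarrow> 'a \<Rightarrow> 'b"
  where "c *\<^sub>R f = (\<lambda>x. c *\<^sub>R f x)"

instance
  by standard (simp_all add: scaleR_fun_def plus_fun_def scaleR_add_right scaleR_add_left)

end

lemma scaleR_fun_apply [simp]: "(c *\<^sub>R f) x = c *\<^sub>R f x"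
  by (simp add: scaleR_fun_def)

text \<open>
  Spaces are linear subspaces \<open>X\<close>, \<open>Y\<close> of an ambient vector space and carry the subspace topology.
  A functional on \<open>X\<close> is represented by the function on the ambient type that has the value
  \<^term>\<open>undefined\<close> off \<open>X\<close>, so that equality of functionals is equality on \<open>X\<close>.
\<close>

definition dual :: "'v::{real_vector, topological_space} set \<Rightarrow> ('v \<Rightarrow> real) set" where
  "dual X = {\<phi> \<in> extensional X.
     (\<forall>f\<in>X. \<forall>g\<in>X. \<phi> (f + g) = \<phi> f + \<phi> g) \<and>
     (\<forall>c. \<forall>f\<in>X. \<phi> (c *\<^sub>R f) = c * \<phi> f) \<and>
     continuous_on X \<phi>}"

definition chi :: "'v set \<Rightarrow> ('v \<Rightarrow> real) \<Rightarrow> ('v \<Rightarrow> real) \<Rightarrow> ereal" where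
  "chi X \<rho> \<phi> = (SUP f \<in> {f \<in> X. \<rho> f \<le> 1}. ereal \<bar>\<phi> f\<bar>)"

definition HBE ::
  "'v::{real_vector, topological_space} set \<Rightarrow> 'v set \<Rightarrow> ('v \<Rightarrow> real) \<Rightarrow> ('v \<Rightarrow> real) \<Rightarrow> ('v \<Rightarrow> real) set"
  where
  "HBE X Y h \<rho> = {g \<in> dual X. restrict g Y = h \<and> chi X \<rho> g = chi Y \<rho> h}"

text \<open>
  For \<open>\<rho> \<succeq> \<mu>\<close> one has \<^term>\<open>chi Y \<rho> h \<le> chi Y \<mu> h\<close>, so all the pairs \<open>(h, \<rho>)\<close> below are pairs with
  \<^term>\<open>chi Y \<rho> h < \<infinity>\<close>, for which Hahn-Banach extensions are considered.
\<close>

definition property_SNP ::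
  "('v::{real_vector, topological_space} \<Rightarrow> real) set \<Rightarrow> 'v set \<Rightarrow> 'v set \<Rightarrow> bool" where
  "property_SNP P X Y \<longleftrightarrow>
     (\<forall>h \<in> dual Y. \<exists>\<mu> \<in> P. chi Y \<mu> h < \<infinity> \<and>
        (\<exists>g \<in> dual X. \<forall>\<rho> \<in> P. (\<forall>f \<in> X. \<mu> f \<le> \<rho> f) \<longrightarrow> HBE X Y h \<rho> = {g}))"

text \<open>
  The topology of the type \<open>'z \<Rightarrow> real\<close> is the product topology, that is, the topology of pointwise
  convergence; its restriction to the set below makes that set the space \<open>C\<^sub>p(Z)\<close>.
\<close>

definition Cp :: "('z::topological_space \<Rightarrow> real) set" where
  "Cp = {f. continuous_on UNIV f}"

text \<open>Inserting 0 gives the value 0 for \<open>F = {}\<close> and changes nothing for other \<open>F\<close>.\<close>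

definition rho :: "'z set \<Rightarrow> ('z \<Rightarrow> real) \<Rightarrow> real" where
  "rho F f = Max (insert 0 ((\<lambda>x. \<bar>f x\<bar>) ` F))"

end

theory Submission
  imports Defs
begin

text \<open>
  If \<open>|f\<^sub>0|\<close> attains its maximum over a finite set \<open>F\<close> at \<open>z \<in> F\<close>, then \<open>f \<mapsto> h f\<^sub>0 / f\<^sub>0 z * f z\<close> is a
  Hahn-Banach extension of \<open>(h, \<rho>\<^sub>F)\<close>. When the maximum is strict it is the only one: an extension \<open>g\<close>
  satisfies \<open>|g (f\<^sub>0 + t f)| \<le> |h f\<^sub>0|\<close> for \<open>f z = 0\<close> and small \<open>|t|\<close>, which forces \<open>g f = 0\<close>. Conversely,
  an extension \<open>g\<close> of a nonzero \<open>h\<close> that is unique for \<open>\<rho>\<^sub>F\<close> and all larger seminorms is a multiple of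
  the evaluation at one point \<open>z\<close>, and enlarging \<open>F\<close> by any \<open>w \<noteq> z\<close> shows \<open>|f\<^sub>0 w| < |f\<^sub>0 z|\<close>.
\<close>

section \<open>The seminorms \<open>rho F\<close>, dual norms and the space
  \<open>Cp\<close>\<close>

lemma rho_le_iff:
  assumes "finite F"
  shows "rho F f \<le> c \<longleftrightarrow> 0 \<le> c \<and> (\<forall>x\<in>F. \<bar>f x\<bar> \<le> c)"
  using assms by (simp add: rho_def)

lemma abs_le_rho:
  assumes "finite F" "x \<in> F"
  shows "\<bar>f x\<bar> \<le> rho F f"
  using assms by (simp add: rho_def)

lemma rho_mono:
  assumes "finite G" "F \<subseteq> G"
  shows "rho F f \<le> rho G f"
  unfolding rho_def using assms by (intro Max_mono) auto

lemma chi_eqI: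
  assumes "\<And>f. f \<in> X \<Longrightarrow> \<rho> f \<le> 1 \<Longrightarrow> \<bar>\<phi> f\<bar> \<le> c"
    and "f \<in> X" "\<rho> f \<le> 1" "\<bar>\<phi> f\<bar> = c"
  shows "chi X \<rho> \<phi> = ereal c"
  unfolding chi_def
proof (rule SUP_eqI)
  show "ereal c \<le> y" if "\<And>f. f \<in> {f \<in> X. \<rho> f \<le> 1} \<Longrightarrow> ereal \<bar>\<phi> f\<bar> \<le> y" for y
    using that[of f] assms by auto
qed (use assms(1) in auto)

lemma abs_le_of_chi:
  assumes "chi X \<rho> \<phi> = ereal c" "f \<in> X" "\<rho> f \<le> 1"
  shows "\<bar>\<phi> f\<bar> \<le> c"
proof -
  have "ereal \<bar>\<phi> f\<bar> \<le> chi X \<rho> \<phi>"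
    unfolding chi_def using assms by (intro SUP_upper) auto
  then show ?thesis using assms by simp
qed

lemma dual_add: "\<phi> \<in> dual X \<Longrightarrow> f \<in> X \<Longrightarrow> g \<in> X \<Longrightarrow> \<phi> (f + g) = \<phi> f + \<phi> g"
  and dual_scaleR: "\<phi> \<in> dual X \<Longrightarrow> f \<in> X \<Longrightarrow> \<phi> (c *\<^sub>R f) = c * \<phi> f"
  and dual_extensional: "\<phi> \<in> dual X \<Longrightarrow> \<phi> \<in> extensional X"
  by (simp_all add: dual_def)

lemma Cp_add: "f \<in> Cp \<Longrightarrow> g \<in> Cp \<Longrightarrow> f + g \<in> Cp"
  and Cp_scaleR: "f \<in> Cp \<Longrightarrow> c *\<^sub>R f \<in> Cp"
  and Cp_const: "(\<lambda>_. c) \<in> Cp"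
  by (auto simp: Cp_def plus_fun_def scaleR_fun_def intro!: continuous_intros)

lemma subspace_Cp: "subspace (Cp :: ('z::topological_space \<Rightarrow> real) set)"
  unfolding subspace_def using Cp_add Cp_scaleR Cp_const[of 0] by (auto simp: zero_fun_def)

section \<open>Scaled point evaluations as Hahn-Banach extensions\<close>

lemma eval_in_dual:
  fixes X :: "('z \<Rightarrow> real) set"
  assumes "subspace X"
  shows "restrict (\<lambda>f. a * f z) X \<in> dual X"
proof -
  have "continuous_on X (\<lambda>f. a * f z)"
    by (intro continuous_intros continuous_on_subset[OF continuous_on_product_coordinates]) auto
  then have "continuous_on X (restrict (\<lambda>f. a * f z) X)"
    by (simp cong: continuous_on_cong)
  then show ?thesis
    using assms by (auto simp: dual_def subspace_def algebra_simps)
qed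

lemma chi_eval:
  assumes "finite F" "z \<in> F"
  shows "chi Cp (rho F) (restrict (\<lambda>f. a * f z) Cp) = ereal \<bar>a\<bar>"
proof (rule chi_eqI[where f = "\<lambda>_. 1"])
  fix f :: "'a \<Rightarrow> real"
  assume "f \<in> Cp" "rho F f \<le> 1"
  then have "\<bar>f z\<bar> \<le> 1" using assms by (simp add: rho_le_iff)
  then show "\<bar>restrict (\<lambda>f. a * f z) Cp f\<bar> \<le> \<bar>a\<bar>"
    using \<open>f \<in> Cp\<close> by (simp add: abs_mult mult_left_le)
qed (use assms in \<open>auto simp: rho_le_iff Cp_const\<close>)

text \<open>On the line spanned by \<open>f0\<close>, the unit ball of \<open>rho F\<close> consists
  of the multiples \<open>c *\<^sub>R f0\<close> with |c| at most 1 / |f0 z|, so the supremum is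
  attained at \<open>f0\<close> divided by \<open>f0 z\<close>.\<close>

lemma chi_span_singleton:
  assumes "h \<in> dual (span {f0})" "finite F" "z \<in> F" "f0 z \<noteq> 0" "\<And>x. x \<in> F \<Longrightarrow> \<bar>f0 x\<bar> \<le> \<bar>f0 z\<bar>"
  shows "chi (span {f0}) (rho F) h = ereal \<bar>h f0 / f0 z\<bar>"
proof (rule chi_eqI[where f = "(1 / f0 z) *\<^sub>R f0"])
  have f0: "f0 \<in> span {f0}" by (simp add: span_base)
  then show "(1 / f0 z) *\<^sub>R f0 \<in> span {f0}" by (rule span_scale)
  show "rho F ((1 / f0 z) *\<^sub>R f0) \<le> 1"
    using assms by (auto simp: rho_le_iff divide_simps)
  show "\<bar>h ((1 / f0 z) *\<^sub>R f0)\<bar> = \<bar>h f0 / f0 z\<bar>"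
    by (simp add: dual_scaleR[OF assms(1) f0])
  fix f
  assume "f \<in> span {f0}" "rho F f \<le> 1"
  then obtain c where c: "f = c *\<^sub>R f0" by (auto simp: span_singleton)
  have "\<bar>f z\<bar> \<le> 1" using \<open>rho F f \<le> 1\<close> assms by (simp add: rho_le_iff)
  then have "\<bar>c\<bar> * \<bar>f0 z\<bar> \<le> 1" by (simp add: c abs_mult)
  then have "\<bar>c\<bar> \<le> 1 / \<bar>f0 z\<bar>" using assms(4) by (simp add: field_simps)
  then have "\<bar>c\<bar> * \<bar>h f0\<bar> \<le> 1 / \<bar>f0 z\<bar> * \<bar>h f0\<bar>" by (rule mult_right_mono) simp
  then show "\<bar>h f\<bar> \<le> \<bar>h f0 / f0 z\<bar>"
    by (simp add: c dual_scaleR[OF assms(1) f0] abs_mult)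
qed

text \<open>Both dual norms equal |h f0 / f0 z|. The maximum over \<open>F\<close> may be attained
  at several points, each of which yields an extension; the converse direction exploits
  this.\<close>

lemma eval_in_HBE:
  fixes f0 :: "'z::topological_space \<Rightarrow> real"
  assumes "f0 \<in> Cp" "h \<in> dual (span {f0})" "finite F" "z \<in> F" "f0 z \<noteq> 0"
    and "\<And>x. x \<in> F \<Longrightarrow> \<bar>f0 x\<bar> \<le> \<bar>f0 z\<bar>"
  shows "restrict (\<lambda>f. h f0 / f0 z * f z) Cp \<in> HBE Cp (span {f0}) h (rho F)"
proof -
  let ?g = "restrict (\<lambda>f. h f0 / f0 z * f z) Cp"
  have f0: "f0 \<in> span {f0}" by (simp add: span_base)
  have "restrict ?g (span {f0}) = h"
  proof (rule extensionalityI[of _ "span {f0}"])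
    fix f assume f: "f \<in> span {f0}"
    then obtain c where c: "f = c *\<^sub>R f0" by (auto simp: span_singleton)
    show "restrict ?g (span {f0}) f = h f"
      using f assms(5) by (simp add: c Cp_scaleR[OF assms(1)] dual_scaleR[OF assms(2) f0])
  qed (rule restrict_extensional, rule dual_extensional[OF assms(2)])
  moreover have "chi Cp (rho F) ?g = chi (span {f0}) (rho F) h"
    by (simp only: chi_eval[OF assms(3,4)] chi_span_singleton[OF assms(2-6)])
  ultimately show ?thesis
    unfolding HBE_def by (intro CollectI conjI eval_in_dual[OF subspace_Cp])
qed

section \<open>Uniqueness of the extension at a strict maximum\<close>

lemma HBE_vanishes:
  fixes f0 :: "'z::topological_space \<Rightarrow> real"
  assumes "f0 \<in> Cp" "h \<in> dual (span {f0})" "finite F" "z \<in> F" "f0 z \<noteq> 0"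
    and strict: "\<And>x. x \<in> F \<Longrightarrow> x \<noteq> z \<Longrightarrow> \<bar>f0 x\<bar> < \<bar>f0 z\<bar>"
    and g: "g \<in> HBE Cp (span {f0}) h (rho F)"
    and f: "f \<in> Cp" "f z = 0"
  shows "g f = 0"
proof -
  have gd: "g \<in> dual Cp" and gh: "restrict g (span {f0}) = h"
    and gc: "chi Cp (rho F) g = chi (span {f0}) (rho F) h"
    using g by (auto simp: HBE_def)
  have le: "\<And>x. x \<in> F \<Longrightarrow> \<bar>f0 x\<bar> \<le> \<bar>f0 z\<bar>" using strict by force
  have f0: "f0 \<in> span {f0}" by (simp add: span_base)
  have gf0: "g f0 = h f0" using gh f0 by (metis restrict_apply')
  have chi: "chi Cp (rho F) g = ereal \<bar>h f0 / f0 z\<bar>"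
    using gc chi_span_singleton[OF assms(2-5) le] by simp
  have "\<exists>e>0. \<forall>t. \<bar>t\<bar> \<le> e \<longrightarrow> \<bar>f0 x + t * f x\<bar> \<le> \<bar>f0 z\<bar>" if "x \<in> F" for x
  proof (cases "x = z")
    case True
    then show ?thesis using f by (intro exI[of _ 1]) auto
  next
    case False
    \<comment> \<open>The perturbation \<open>t * f x\<close> has to fit into the gap |f0 z| - |f0
      x|; the summand 1 keeps the denominator positive when \<open>f x = 0\<close>.\<close>
    define e where "e = (\<bar>f0 z\<bar> - \<bar>f0 x\<bar>) / (\<bar>f x\<bar> + 1)"
    have "0 < e" using strict[OF that False] by (simp add: e_def)
    moreover have "\<bar>f0 x + t * f x\<bar> \<le> \<bar>f0 z\<bar>" if "\<bar>t\<bar> \<le> e" for t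
    proof -
      have "\<bar>t * f x\<bar> \<le> e * (\<bar>f x\<bar> + 1)"
        unfolding abs_mult using that \<open>0 < e\<close> by (intro mult_mono) auto
      also have "\<dots> = \<bar>f0 z\<bar> - \<bar>f0 x\<bar>"
        unfolding e_def using abs_ge_zero[of "f x"]
        by (metis add_nonneg_pos less_irrefl nonzero_eq_divide_eq zero_less_one)
      finally show ?thesis by linarith
    qed
    ultimately show ?thesis by blast
  qed
  then obtain e where e: "\<And>x. x \<in> F \<Longrightarrow> 0 < e x"
    "\<And>x t. x \<in> F \<Longrightarrow> \<bar>t\<bar> \<le> e x \<Longrightarrow> \<bar>f0 x + t * f x\<bar> \<le> \<bar>f0 z\<bar>"
    by metis
  define d where "d = Min (e ` F)"
  have "F \<noteq> {}" using assms(4) by auto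
  then have "0 < d" using e assms(3) by (simp add: d_def)
  have bound: "\<bar>h f0 + t * g f\<bar> \<le> \<bar>h f0\<bar>" if "\<bar>t\<bar> \<le> d" for t
  proof -
    \<comment> \<open>Division by \<open>f0 z\<close> brings the perturbed function into the unit
      ball of \<open>rho F\<close>, where the dual norm of \<open>g\<close> bounds its
      value.\<close>
    define k where "k = (1 / f0 z) *\<^sub>R (f0 + t *\<^sub>R f)"
    have k: "k \<in> Cp" unfolding k_def by (intro Cp_scaleR Cp_add assms f)
    have "\<bar>f0 x + t * f x\<bar> \<le> \<bar>f0 z\<bar>" if "x \<in> F" for x
      using e(2)[OF that] \<open>\<bar>t\<bar> \<le> d\<close> assms(3) that unfolding d_def
      by (metis (no_types, lifting) Min_le finite_imageI imageI order_trans)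
    then have "rho F k \<le> 1" using assms by (auto simp: rho_le_iff k_def divide_simps)
    then have "\<bar>g k\<bar> \<le> \<bar>h f0 / f0 z\<bar>" using abs_le_of_chi[OF chi k] by simp
    moreover have "g k = (h f0 + t * g f) / f0 z"
      by (simp add: k_def dual_scaleR[OF gd] dual_add[OF gd] Cp_add Cp_scaleR assms f gf0)
    ultimately show ?thesis using assms(5) by (simp add: divide_simps)
  qed
  \<comment> \<open>If both a + b and a - b have absolute value at most |a|, then b = 0; here a is
    \<open>h f0\<close> and b is \<open>d * g f\<close>.\<close>
  have "d * g f = 0"
    using bound[of d] bound[of "- d"] \<open>0 < d\<close> by (auto simp: abs_if split: if_splits)
  then show ?thesis using \<open>0 < d\<close> by simp
qed

lemma HBE_unique:
  fixes f0 :: "'z::topological_space \<Rightarrow> real"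
  assumes "f0 \<in> Cp" "h \<in> dual (span {f0})" "finite F" "z \<in> F" "f0 z \<noteq> 0"
    and strict: "\<And>x. x \<in> F \<Longrightarrow> x \<noteq> z \<Longrightarrow> \<bar>f0 x\<bar> < \<bar>f0 z\<bar>"
  shows "HBE Cp (span {f0}) h (rho F) = {restrict (\<lambda>f. h f0 / f0 z * f z) Cp}"
proof -
  have "g = restrict (\<lambda>f. h f0 / f0 z * f z) Cp" if g: "g \<in> HBE Cp (span {f0}) h (rho F)" for g
  proof (rule extensionalityI[of _ Cp])
    have gd: "g \<in> dual Cp" and gh: "restrict g (span {f0}) = h"
      using g by (auto simp: HBE_def)
    have gf0: "g f0 = h f0" using gh by (metis restrict_apply' span_base singletonI)
    show "g \<in> extensional Cp" by (rule dual_extensional[OF gd])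
    fix f :: "'z \<Rightarrow> real" assume f: "f \<in> Cp"
    \<comment> \<open>Subtracting the multiple of \<open>f0\<close> that agrees with
      \<open>f\<close> at \<open>z\<close> leaves a function vanishing at \<open>z\<close>, and on
      that multiple \<open>g\<close> is prescribed by \<open>h\<close>.\<close>
    have "g (f + (- f z / f0 z) *\<^sub>R f0) = 0"
      using assms(1,5) by (intro HBE_vanishes[OF assms g] Cp_add Cp_scaleR f) auto
    then have "g f + (- f z / f0 z) * h f0 = 0"
      using f assms(1) gf0 by (simp only: dual_add[OF gd] dual_scaleR[OF gd] Cp_scaleR)
    then show "g f = restrict (\<lambda>f. h f0 / f0 z * f z) Cp f" using f by (simp add: field_simps)
  qed simp
  moreover have "\<bar>f0 x\<bar> \<le> \<bar>f0 z\<bar>" if "x \<in> F" for x using strict[OF that] by force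
  ultimately show ?thesis using eval_in_HBE[OF assms(1-5)] by blast
qed

section \<open>Separating functions and the supremum condition\<close>

text \<open>Finite sets are closed in a Hausdorff space, so complete regularity applies to them. The
  function is used both to recover points of \<open>F\<close> from \<open>rho F\<close> and to tell
  evaluations at distinct points apart.\<close>

lemma completely_regular_separate:
  fixes z :: "'z::t2_space"
  assumes "completely_regular_space (euclidean :: 'z topology)" "finite F" "z \<notin> F"
  obtains f where "f \<in> Cp" "f z = 1" "\<And>x. x \<in> F \<Longrightarrow> f x = (0::real)"
proof -
  have "closedin (euclidean :: 'z topology) F" using finite_imp_closed[OF assms(2)] by simp
  then obtain f :: "'z \<Rightarrow> real" where f: "continuous_map euclidean euclideanreal f" "f z = 1"
      "f ` F \<subseteq> {0}"
    using completely_regular_space_gen_alt[of 1 0, THEN iffD1, OF _ assms(1)] assms(3)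
    by (metis Diff_iff UNIV_I topspace_euclidean zero_neq_one)
  then show ?thesis by (intro that[of f]) (auto simp: Cp_def)
qed

text \<open>The supremum is taken in \<open>ereal\<close>, so for unbounded \<open>f\<close> it is
  infinite and no point attains it. Otherwise a unique maximiser is the same as a strict
  one.\<close>

lemma ex1_abs_eq_SUP_iff:
  fixes f :: "'z \<Rightarrow> real"
  shows "(\<exists>!z. ereal \<bar>f z\<bar> = (SUP x. ereal \<bar>f x\<bar>)) \<longleftrightarrow> (\<exists>z. \<forall>w. w \<noteq> z \<longrightarrow> \<bar>f w\<bar> < \<bar>f z\<bar>)"
proof -
  have max: "ereal \<bar>f z\<bar> = (SUP x. ereal \<bar>f x\<bar>) \<longleftrightarrow> (\<forall>w. \<bar>f w\<bar> \<le> \<bar>f z\<bar>)" for z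
  proof
    assume "ereal \<bar>f z\<bar> = (SUP x. ereal \<bar>f x\<bar>)"
    then show "\<forall>w. \<bar>f w\<bar> \<le> \<bar>f z\<bar>" by (metis SUP_upper UNIV_I ereal_less_eq(3))
  next
    assume "\<forall>w. \<bar>f w\<bar> \<le> \<bar>f z\<bar>"
    then show "ereal \<bar>f z\<bar> = (SUP x. ereal \<bar>f x\<bar>)" by (intro SUP_eqI[symmetric]) auto
  qed
  show ?thesis
  proof
    assume "\<exists>!z. ereal \<bar>f z\<bar> = (SUP x. ereal \<bar>f x\<bar>)"
    then obtain z where z: "\<And>w. \<bar>f w\<bar> \<le> \<bar>f z\<bar>" "\<And>y. \<forall>w. \<bar>f w\<bar> \<le> \<bar>f y\<bar> \<Longrightarrow> y = z"
      unfolding max by blast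
    then have "\<bar>f w\<bar> < \<bar>f z\<bar>" if "w \<noteq> z" for w
      using that by (meson linorder_not_less order_trans)
    then show "\<exists>z. \<forall>w. w \<noteq> z \<longrightarrow> \<bar>f w\<bar> < \<bar>f z\<bar>" by blast
  next
    assume "\<exists>z. \<forall>w. w \<noteq> z \<longrightarrow> \<bar>f w\<bar> < \<bar>f z\<bar>"
    then obtain z where z: "\<And>w. w \<noteq> z \<Longrightarrow> \<bar>f w\<bar> < \<bar>f z\<bar>" by blast
    then have "\<bar>f w\<bar> \<le> \<bar>f z\<bar>" for w by (cases "w = z") (auto intro: less_imp_le)
    moreover have "y = z" if "\<forall>w. \<bar>f w\<bar> \<le> \<bar>f y\<bar>" for y
      using that z by (meson linorder_not_less)
    ultimately show "\<exists>!z. ereal \<bar>f z\<bar> = (SUP x. ereal \<bar>f x\<bar>)" unfolding max by blast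
  qed
qed

section \<open>The two implications\<close>

text \<open>The single seminorm \<open>rho {z}\<close> serves for every \<open>h\<close>: whatever
  dominates it is some \<open>rho F\<close> with \<open>z\<close> in \<open>F\<close>, and
  \<open>z\<close> is then a strict maximiser over \<open>F\<close>.\<close>

lemma property_SNP_if_strict_max:
  fixes f0 :: "'z::t2_space \<Rightarrow> real"
  assumes "completely_regular_space (euclidean :: 'z topology)" "f0 \<in> Cp" "f0 \<noteq> 0"
    and strict: "\<And>w. w \<noteq> z \<Longrightarrow> \<bar>f0 w\<bar> < \<bar>f0 z\<bar>"
  shows "property_SNP {rho F |F. finite F} Cp (span {f0})"
  unfolding property_SNP_def
proof (intro ballI, rule bexI[of _ "rho {z}"], rule conjI)
  fix h assume h: "h \<in> dual (span {f0})"
  have nz: "f0 z \<noteq> 0"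
  proof
    assume "f0 z = 0"
    then have "f0 w = 0" for w using strict[of w] by (cases "w = z") auto
    then show False using assms(3) by (auto simp: fun_eq_iff)
  qed
  show "chi (span {f0}) (rho {z}) h < \<infinity>"
    using chi_span_singleton[OF h, of "{z}" z] nz by simp
  show "\<exists>g\<in>dual Cp. \<forall>\<rho>\<in>{rho F |F. finite F}. (\<forall>f\<in>Cp. rho {z} f \<le> \<rho> f) \<longrightarrow> HBE Cp (span {f0}) h \<rho> = {g}"
  proof (intro bexI[of _ "restrict (\<lambda>f. h f0 / f0 z * f z) Cp"] ballI impI)
    fix \<rho> :: "('z \<Rightarrow> real) \<Rightarrow> real"
    assume "\<rho> \<in> {rho F |F. finite F}" and dom: "\<forall>f\<in>Cp. rho {z} f \<le> \<rho> f"
    then obtain F where F: "\<rho> = rho F" "finite F" by auto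
    \<comment> \<open>Otherwise a continuous function that is 1 at \<open>z\<close> and 0 on
      \<open>F\<close> violates the domination; this includes \<open>F = {}\<close>, where
      \<open>rho F\<close> is 0.\<close>
    have "z \<in> F"
    proof (rule ccontr)
      assume "z \<notin> F"
      then obtain f where f: "f \<in> Cp" "f z = 1" "\<And>x. x \<in> F \<Longrightarrow> f x = 0"
        using completely_regular_separate[OF assms(1) F(2)] by metis
      then have "rho F f \<le> 0" using F by (simp add: rho_le_iff)
      moreover have "1 \<le> rho {z} f" using abs_le_rho[of "{z}" z f] f by simp
      ultimately show False using dom f F by force
    qed
    then show "HBE Cp (span {f0}) h \<rho> = {restrict (\<lambda>f. h f0 / f0 z * f z) Cp}"
      unfolding F(1) using HBE_unique[OF assms(2) h F(2)] nz strict by blast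
  qed (rule eval_in_dual[OF subspace_Cp])
qed auto

lemma strict_max_if_property_SNP:
  fixes f0 :: "'z::t2_space \<Rightarrow> real"
  assumes "completely_regular_space (euclidean :: 'z topology)" "f0 \<in> Cp" "f0 \<noteq> 0"
    and SNP: "property_SNP {rho F |F. finite F} Cp (span {f0})"
  obtains z where "\<And>w. w \<noteq> z \<Longrightarrow> \<bar>f0 w\<bar> < \<bar>f0 z\<bar>"
proof -
  obtain z0 where z0: "f0 z0 \<noteq> 0" using assms(3) by (auto simp: fun_eq_iff)
  have f0: "f0 \<in> span {f0}" by (simp add: span_base)
  \<comment> \<open>One nonzero functional suffices. Taking a point evaluation makes it continuous,
    and the factor normalises \<open>h f0\<close> to 1.\<close>
  define h where "h = restrict (\<lambda>f. 1 / f0 z0 * f z0) (span {f0})"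
  have h: "h \<in> dual (span {f0})" unfolding h_def by (intro eval_in_dual) simp
  have hf0: "h f0 = 1" using z0 f0 by (simp add: h_def)
  obtain F g where F: "finite F" "chi (span {f0}) (rho F) h < \<infinity>"
    and g: "\<And>\<rho>. \<rho> \<in> {rho F |F. finite F} \<Longrightarrow> (\<forall>f\<in>Cp. rho F f \<le> \<rho> f) \<Longrightarrow>
      HBE Cp (span {f0}) h \<rho> = {g}"
  proof -
    obtain \<mu> g where \<mu>: "\<mu> \<in> {rho F |F. finite F}" "chi (span {f0}) \<mu> h < \<infinity>"
      "\<forall>\<rho> \<in> {rho F |F. finite F}. (\<forall>f\<in>Cp. \<mu> f \<le> \<rho> f) \<longrightarrow> HBE Cp (span {f0}) h \<rho> = {g}"
      using SNP[unfolded property_SNP_def, THEN bspec, OF h] by (elim bexE conjE) rule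
    from \<mu>(1) obtain F where "\<mu> = rho F" "finite F" by auto
    with \<mu>(2,3) show ?thesis by (intro that[of F g]) simp_all
  qed
  \<comment> \<open>If \<open>f0\<close> vanished on \<open>F\<close>, all its multiples would lie
    in the unit ball of \<open>rho F\<close>, making the dual norm of \<open>h\<close>
    infinite.\<close>
  have "\<exists>y\<in>F. f0 y \<noteq> 0"
  proof (rule ccontr)
    assume F0: "\<not> (\<exists>y\<in>F. f0 y \<noteq> 0)"
    have "ereal (real n) \<le> chi (span {f0}) (rho F) h" for n
    proof -
      have "rho F (real n *\<^sub>R f0) \<le> 1" using F0 F by (auto simp: rho_le_iff)
      then have "ereal \<bar>h (real n *\<^sub>R f0)\<bar> \<le> chi (span {f0}) (rho F) h"
        unfolding chi_def by (intro SUP_upper CollectI conjI span_scale[OF f0])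
      then show ?thesis using hf0 by (simp add: dual_scaleR[OF h f0])
    qed
    then have "chi (span {f0}) (rho F) h = \<infinity>"
      by (intro ereal_top) (meson ereal_less_eq(3) order_trans real_arch_simple)
    then show False using F by simp
  qed
  then obtain y where y: "y \<in> F" "f0 y \<noteq> 0" by blast
  \<comment> \<open>\<open>rho G\<close> dominates \<open>rho F\<close>, so the same
    \<open>g\<close> is its only extension, and every maximiser over \<open>G\<close> must produce
    it.\<close>
  have rep: "g = restrict (\<lambda>f. 1 / f0 z * f z) Cp"
    if "finite G" "F \<subseteq> G" "z \<in> G" "\<And>x. x \<in> G \<Longrightarrow> \<bar>f0 x\<bar> \<le> \<bar>f0 z\<bar>" for G z
  proof -
    have "f0 z \<noteq> 0" using that(4)[of y] that(2) y by auto
    then have "restrict (\<lambda>f. h f0 / f0 z * f z) Cp \<in> HBE Cp (span {f0}) h (rho G)"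
      by (intro eval_in_HBE[OF assms(2) h that(1,3)] that(4))
    moreover have "HBE Cp (span {f0}) h (rho G) = {g}"
      using that(1,2) by (intro g) (auto intro: rho_mono)
    ultimately show ?thesis using hf0 by simp
  qed
  have eq: "z = z'" if "f0 z \<noteq> 0"
    "restrict (\<lambda>f. 1 / f0 z * f z) Cp = restrict (\<lambda>f. 1 / f0 z' * f z') Cp" for z z'
  proof (rule ccontr)
    assume "z \<noteq> z'"
    then obtain f where f: "f \<in> Cp" "f z = 1" "f z' = 0"
      using completely_regular_separate[OF assms(1), of "{z'}" z] by (metis finite.simps singletonD singletonI)
    then show False using fun_cong[OF that(2), of f] that(1) by simp
  qed
  have attain: "\<exists>z\<in>G. \<forall>x\<in>G. \<bar>f0 x\<bar> \<le> \<bar>f0 z\<bar>" if "finite G" "F \<subseteq> G" for G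
  proof -
    have "finite ((\<lambda>x. \<bar>f0 x\<bar>) ` G)" "(\<lambda>x. \<bar>f0 x\<bar>) ` G \<noteq> {}" using that y by auto
    then have "Max ((\<lambda>x. \<bar>f0 x\<bar>) ` G) \<in> (\<lambda>x. \<bar>f0 x\<bar>) ` G" by (rule Max_in)
    then obtain z where "z \<in> G" "\<bar>f0 z\<bar> = Max ((\<lambda>x. \<bar>f0 x\<bar>) ` G)" by (metis imageE)
    then show ?thesis using that(1) by (intro bexI[of _ z]) auto
  qed
  obtain z where z: "z \<in> F" "\<forall>x\<in>F. \<bar>f0 x\<bar> \<le> \<bar>f0 z\<bar>" using attain[OF F(1)] by blast
  have nz: "f0 z \<noteq> 0" using z y by force
  have gz: "g = restrict (\<lambda>f. 1 / f0 z * f z) Cp" using rep[OF F(1) order_refl] z by blast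
  \<comment> \<open>Here \<open>g\<close> is independent of \<open>w\<close>, and evaluations at
    distinct points differ, so adding any one point to \<open>F\<close> cannot create another
    maximiser.\<close>
  have max_eq: "z' = z"
    if "z' \<in> insert w F" "\<forall>x\<in>insert w F. \<bar>f0 x\<bar> \<le> \<bar>f0 z'\<bar>" for w z'
  proof -
    have "g = restrict (\<lambda>f. 1 / f0 z' * f z') Cp"
      using rep[of "insert w F" z'] that F(1) by blast
    then show ?thesis using eq[OF nz, of z'] gz by simp
  qed
  show ?thesis
  proof (rule that)
    fix w assume "w \<noteq> z"
    show "\<bar>f0 w\<bar> < \<bar>f0 z\<bar>"
    proof (rule ccontr)
      assume "\<not> \<bar>f0 w\<bar> < \<bar>f0 z\<bar>"
      then have "\<forall>x\<in>insert w F. \<bar>f0 x\<bar> \<le> \<bar>f0 w\<bar>" using z by force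
      then show False using max_eq[of w w] \<open>w \<noteq> z\<close> by simp
    qed
  qed
qed

text \<open>The Tychonoff condition is the class \<open>t2_space\<close> together with complete
  regularity. The case \<open>f0 = 0\<close> is excluded because the zero subspace always has the
  property, its only extension being 0, whereas |0| attains its supremum everywhere.\<close>

theorem theorem4p6:
  fixes f0 :: "'z::t2_space \<Rightarrow> real"
  assumes "completely_regular_space (euclidean :: 'z topology)"
    and "f0 \<in> Cp" and "f0 \<noteq> 0"
  shows "property_SNP {rho F |F. finite F} Cp (span {f0}) \<longleftrightarrow>
    (\<exists>!z. ereal \<bar>f0 z\<bar> = (SUP x. ereal \<bar>f0 x\<bar>))"
  unfolding ex1_abs_eq_SUP_iff
proof
  assume "property_SNP {rho F |F. finite F} Cp (span {f0})"
  then show "\<exists>z. \<forall>w. w \<noteq> z \<longrightarrow> \<bar>f0 w\<bar> < \<bar>f0 z\<bar>"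
    by (rule strict_max_if_property_SNP[OF assms]) blast
next
  assume "\<exists>z. \<forall>w. w \<noteq> z \<longrightarrow> \<bar>f0 w\<bar> < \<bar>f0 z\<bar>"
  then show "property_SNP {rho F |F. finite F} Cp (span {f0})"
    by (elim exE, intro property_SNP_if_strict_max[OF assms]) blast
qed

end
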